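(* Let $(X,f)$ be a topological dynamical system, let $A\subset X$ be a weakly mixing set of order $2$ for $(X,f)$ and let $U\subset X$ be an open set with $U\cap A\neq\emptyset$. Then there is $x\in U\cap A$ such that for every open set $V\subset X$ with $V\cap A\neq\emptyset$ the set $N_f(x,V)$ contains an IP-set. In particular, for every open set $V\subset X$ with $V\cap A\neq\emptyset$ the set $N_f(U\cap A,V)$ contains an IP-set.
   Context: $\mathbb{N}$ is the set of positive integers. A topological dynamical system is a pair $(X,f)$ where $X$ is a compact metric space and $f\colon X\to X$ is continuous. $N_f(x,B)=\{n\in\mathbb{N}: f^n(x)\in B\}$ for $x\in X$, $B\subset X$; $N_f(C,B)=\{n\in\mathbb{N}: f^n(C)\cap B\neq\emptyset\}$ for $C,B\subset X$. A set $S\subset\mathbb{N}$ is an IP-set if there is a sequence $\{p_i\}_{i=1}^\infty\subset\mathbb{N}$ such that $S$ consists exactly of the numbers $p_i$ together with all finite sums $p_{n_1}+\dots+p_{n_k}$ with $n_1<\dots<n_k$, $k\in\mathbb{N}$. A closed set $A\subset X$ containing at least two points is a weakly mixing set of order $n$ if for any open subsets $V_1,U_1,\dots,V_n,U_n$ of $X$ with $A\cap U_i\neq\emptyset$ and $A\cap V_i\neq\emptyset$ for $i=1,\dots,n$, there exists $k>0$ such that $f^k(V_i\cap A)\cap U_i\neq\emptyset$ for each $1\le i\le n$. *)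

theory Defs
  imports "HOL-Analysis.Analysis"
begin

text \<open>The phase space is a compact subset \<open>X\<close> of an arbitrary metric space, with the induced
  metric; openness and closedness in the phase space are therefore relative to \<open>X\<close>. The values of
  \<open>f\<close> outside \<open>X\<close> are irrelevant.\<close>

definition top_dyn_sys :: "'a::metric_space set \<Rightarrow> ('a \<Rightarrow> 'a) \<Rightarrow> bool" where
  "top_dyn_sys X f \<longleftrightarrow> compact X \<and> continuous_on X f \<and> f \<in> X \<rightarrow> X"

definition return_times :: "('a \<Rightarrow> 'a) \<Rightarrow> 'a \<Rightarrow> 'a set \<Rightarrow> nat set" where
  "return_times f x B = {n. n > 0 \<and> (f ^^ n) x \<in> B}"

definition hitting_times :: "('a \<Rightarrow> 'a) \<Rightarrow> 'a set \<Rightarrow> 'a set \<Rightarrow> nat set" where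
  "hitting_times f C B = {n. n > 0 \<and> (f ^^ n) ` C \<inter> B \<noteq> {}}"

text \<open>The terms \<open>p i\<close> need not be distinct; the sums range over nonempty finite sets of indices,
  the singletons yielding the terms themselves.\<close>

definition IP_set :: "nat set \<Rightarrow> bool" where
  "IP_set S \<longleftrightarrow>
    (\<exists>p :: nat \<Rightarrow> nat. (\<forall>i. p i > 0) \<and> S = {\<Sum>i\<in>F. p i | F. finite F \<and> F \<noteq> {}})"

definition contains_IP_set :: "nat set \<Rightarrow> bool" where
  "contains_IP_set N \<longleftrightarrow> (\<exists>S. IP_set S \<and> S \<subseteq> N)"

definition weakly_mixing_set ::
    "nat \<Rightarrow> 'a::metric_space set \<Rightarrow> ('a \<Rightarrow> 'a) \<Rightarrow> 'a set \<Rightarrow> bool" where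
  "weakly_mixing_set n X f A \<longleftrightarrow>
    closedin (top_of_set X) A \<and>
    (\<exists>a\<in>A. \<exists>b\<in>A. a \<noteq> b) \<and>
    (\<forall>V U :: nat \<Rightarrow> 'a set.
      (\<forall>i\<in>{1..n}. openin (top_of_set X) (V i) \<and> openin (top_of_set X) (U i) \<and>
                  A \<inter> U i \<noteq> {} \<and> A \<inter> V i \<noteq> {}) \<longrightarrow>
      (\<exists>k>0. \<forall>i\<in>{1..n}. (f ^^ k) ` (V i \<inter> A) \<inter> U i \<noteq> {}))"

end

theory Submission
  imports Defs
begin

text \<open>
  Two ideas give the theorem.

  A point \<open>x\<close> returns to an open set \<open>V\<close> along an IP-set as soon as \<open>V\<close> contains a point \<open>y\<close>
  such that the pair \<open>(x, y)\<close> comes arbitrarily close to \<open>(y, y)\<close> under positive iterates of \<open>f \<times> f\<close>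
  (\<open>return_times_contains_IP_set\<close>): after a time \<open>p\<close> bringing both points into \<open>V\<close>, the set of
  \<open>z \<in> V\<close> with \<open>f\<^sup>p z \<in> V\<close> is a smaller neighbourhood of \<open>y\<close>, to which the same step applies again.

  It remains to find one \<open>x \<in> U \<inter> A\<close> for which such points \<open>y\<close> are dense in \<open>A\<close>. Weak mixing of order
  2 implies that the pairs in \<open>A \<times> A\<close> visiting a given box \<open>B \<times> B\<close>, where \<open>B\<close> is open and meets \<open>A\<close>,
  form an open dense subset of \<open>A \<times> A\<close>. As in the Kuratowski--Ulam theorem, for a generic \<open>x \<in> A\<close>
  the section of that set over \<open>x\<close> is dense in \<open>A\<close>, simultaneously for all \<open>B\<close> in a countable base
  (\<open>generic_dense_sections\<close>). For such an \<open>x\<close>, a generic \<open>y \<in> A\<close> visits together with \<open>x\<close> every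
  basic \<open>B\<close>, in particular the arbitrarily small ones containing \<open>y\<close>. Both uses of genericity are
  the Baire category theorem in the compact space \<open>A\<close>.

  Since \<open>A\<close> need not be invariant under \<open>f\<close>, points of \<open>A\<close> may visit \<open>B\<close> outside \<open>A\<close>. Hence
  targets are open in \<open>X\<close>, whereas genericity refers to \<open>A\<close>.
\<close>

section \<open>Topological preliminaries\<close>

lemma compact_imp_second_countable:
  fixes X :: "'a::metric_space set"
  assumes "compact X"
  shows "second_countable (top_of_set X)"
proof -
  have "\<exists>C. finite C \<and> X \<subseteq> (\<Union>c\<in>C. ball c (1 / real (Suc n)))" for n
    using assms unfolding compact_eq_totally_bounded by (simp del: of_nat_Suc)
  then obtain C where C: "\<And>n. finite (C n)" "\<And>n. X \<subseteq> (\<Union>c\<in>C n. ball c (1 / real (Suc n)))"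
    by metis
  define \<B> where "\<B> = (\<Union>n. (\<lambda>c. X \<inter> ball c (1 / real (Suc n))) ` C n)"
  have "countable \<B>"
    unfolding \<B>_def using C(1) by (simp add: countable_finite)
  moreover have "\<forall>B\<in>\<B>. openin (top_of_set X) B"
    unfolding \<B>_def by auto
  moreover have "\<exists>B\<in>\<B>. y \<in> B \<and> B \<subseteq> W" if W: "openin (top_of_set X) W" "y \<in> W" for W y
  proof -
    obtain e where e: "e > 0" "ball y e \<inter> X \<subseteq> W"
      using W by (metis openin_contains_ball)
    obtain n where n: "1 / real (Suc n) < e / 2"
      using e by (metis half_gt_zero nat_approx_posE)
    have "y \<in> X" using W openin_imp_subset by blast
    then obtain c where c: "c \<in> C n" "dist c y < 1 / real (Suc n)"
      using C(2)[of n] by auto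
    have "X \<inter> ball c (1 / real (Suc n)) \<subseteq> W"
    proof
      fix z assume z: "z \<in> X \<inter> ball c (1 / real (Suc n))"
      have "dist y z \<le> dist c y + dist c z" by (metis dist_commute dist_triangle)
      with c n z have "dist y z < e" by auto
      with z e show "z \<in> W" by auto
    qed
    with c \<open>y \<in> X\<close> show ?thesis unfolding \<B>_def by auto
  qed
  ultimately show ?thesis unfolding second_countable_def by blast
qed

lemma compact_Baire:
  fixes A :: "'a::metric_space set"
  assumes "compact A" "countable \<G>"
    and "\<And>G. G \<in> \<G> \<Longrightarrow> openin (top_of_set A) G"
    and "\<And>G W. \<lbrakk>G \<in> \<G>; openin (top_of_set A) W; W \<noteq> {}\<rbrakk> \<Longrightarrow> G \<inter> W \<noteq> {}"
    and "openin (top_of_set A) W" "W \<noteq> {}"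
  shows "\<exists>x\<in>W. \<forall>G\<in>\<G>. x \<in> G"
proof -
  have "locally_compact_space (top_of_set A) \<and> regular_space (top_of_set A)"
    using assms(1) by (simp add: compact_imp_locally_compact_space compact_space_subtopology
        metrizable_imp_regular_space metrizable_space_subtopology metrizable_space_euclidean)
  then have "top_of_set A closure_of \<Inter>\<G> = topspace (top_of_set A)"
    using assms(2-4) by (intro Baire_category) (auto simp only: dense_intersects_open)
  with assms(5,6) have "\<Inter>\<G> \<inter> W \<noteq> {}"
    unfolding dense_intersects_open by blast
  then show ?thesis by blast
qed

lemma openin_restrict:
  assumes "openin (top_of_set X) S" "A \<subseteq> X"
  shows "openin (top_of_set A) (A \<inter> S)"
proof -
  obtain T where "open T" "S = X \<inter> T" using assms(1) by (auto simp: openin_open)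
  with assms(2) have "A \<inter> S = A \<inter> T" by auto
  with \<open>open T\<close> show ?thesis by (simp add: openin_open_Int)
qed

lemma funpow_continuous_on:
  assumes "continuous_on X f" "f \<in> X \<rightarrow> X"
  shows "continuous_on X (f ^^ n) \<and> f ^^ n \<in> X \<rightarrow> X"
proof (induction n)
  case (Suc n)
  have "continuous_on X (f \<circ> f ^^ n)"
    using Suc assms by (intro continuous_on_compose) (auto intro: continuous_on_subset)
  with Suc assms show ?case by (auto simp: Pi_iff comp_def)
qed auto

lemma openin_funpow_preimage:
  assumes "continuous_on X f" "f \<in> X \<rightarrow> X" "openin (top_of_set X) S" "openin (top_of_set X) B"
  shows "openin (top_of_set X) {z \<in> S. (f ^^ n) z \<in> B}"
proof -
  have "openin (top_of_set X) (X \<inter> (f ^^ n) -` B)"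
    using continuous_openin_preimage[OF _ _ assms(4)] funpow_continuous_on[OF assms(1,2)] by blast
  then have "openin (top_of_set X) (S \<inter> (X \<inter> (f ^^ n) -` B))"
    using assms(3) by blast
  moreover have "S \<inter> (X \<inter> (f ^^ n) -` B) = {z \<in> S. (f ^^ n) z \<in> B}"
    using openin_imp_subset[OF assms(3)] by auto
  ultimately show ?thesis by simp
qed

lemma openin_visits_within:
  assumes "continuous_on X f" "f \<in> X \<rightarrow> X" "A \<subseteq> X" "openin (top_of_set X) B"
  shows "openin (top_of_set A) {x \<in> A. \<exists>k\<in>K. (f ^^ k) x \<in> B}"
proof -
  have "openin (top_of_set X) (\<Union>k\<in>K. {x \<in> X. (f ^^ k) x \<in> B})"
    using openin_funpow_preimage[OF assms(1,2) _ assms(4), of X] by (intro openin_Union) auto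
  moreover have "{x \<in> A. \<exists>k\<in>K. (f ^^ k) x \<in> B} = A \<inter> (\<Union>k\<in>K. {x \<in> X. (f ^^ k) x \<in> B})"
    using assms(3) by auto
  ultimately show ?thesis using openin_restrict[OF _ assms(3)] by simp
qed

section \<open>IP-sets of return times\<close>

text \<open>
  The hypothesis \<open>joint\<close> provides times \<open>p 0, p 1, \<dots>\<close> and decreasing neighbourhoods
  \<open>W 0 = V, W 1, \<dots>\<close> of \<open>y\<close> such that \<open>f\<^bsup>p n\<^esup>\<close> maps \<open>x\<close> and all of \<open>W (Suc n)\<close> into \<open>W n\<close>.
  Applying the largest index of a finite sum first moves \<open>x\<close> down this chain, so the sum over \<open>F\<close>
  brings \<open>x\<close> into \<open>W (Min F) \<subseteq> V\<close>.
\<close>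

lemma return_times_contains_IP_set:
  fixes X :: "'a::metric_space set"
  assumes f: "continuous_on X f" "f \<in> X \<rightarrow> X"
    and V: "openin (top_of_set X) V" "y \<in> V"
    and joint: "\<And>W. \<lbrakk>openin (top_of_set X) W; y \<in> W\<rbrakk> \<Longrightarrow> \<exists>k>0. (f ^^ k) x \<in> W \<and> (f ^^ k) y \<in> W"
  shows "contains_IP_set (return_times f x V)"
proof -
  obtain q where q: "\<And>W. \<lbrakk>openin (top_of_set X) W; y \<in> W\<rbrakk>
      \<Longrightarrow> q W > 0 \<and> (f ^^ q W) x \<in> W \<and> (f ^^ q W) y \<in> W"
    using joint by metis
  define W where "W = rec_nat V (\<lambda>_ W. {z \<in> W. (f ^^ q W) z \<in> W})"
  define p where "p n = q (W n)" for n
  have W0: "W 0 = V" and WSuc: "W (Suc n) = {z \<in> W n. (f ^^ p n) z \<in> W n}" for n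
    by (simp_all add: W_def p_def)
  have W: "openin (top_of_set X) (W n) \<and> y \<in> W n" for n
  proof (induction n)
    case 0
    show ?case using V W0 by simp
  next
    case (Suc n)
    then show ?case
      using q openin_funpow_preimage[OF f] unfolding WSuc by (auto simp: p_def)
  qed
  have p: "p n > 0" "(f ^^ p n) x \<in> W n" for n
    using q W p_def by auto
  have decr: "W n \<subseteq> W m" if "m \<le> n" for m n
    by (rule lift_Suc_antimono_le[OF _ that]) (auto simp: WSuc)
  have sums: "F \<noteq> {} \<longrightarrow> (\<forall>n. (\<forall>i\<in>F. n \<le> i) \<longrightarrow> (f ^^ (\<Sum>i\<in>F. p i)) x \<in> W n)" if "finite F" for F
    using that
  proof (induction F rule: finite_linorder_min_induct)
    case empty
    then show ?case by simp
  next
    case (insert b F)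
    have "(f ^^ (\<Sum>i\<in>insert b F. p i)) x \<in> W b"
    proof (cases "F = {}")
      case True
      then show ?thesis using p by simp
    next
      case False
      have "(f ^^ (\<Sum>i\<in>F. p i)) x \<in> W (Suc b)"
        using insert False by (simp add: Suc_leI)
      moreover have "b \<notin> F" using insert by auto
      ultimately show ?thesis
        using insert by (simp add: WSuc funpow_add)
    qed
    then show ?case using decr by blast
  qed
  have "{\<Sum>i\<in>F. p i | F. finite F \<and> F \<noteq> {}} \<subseteq> return_times f x V"
  proof
    fix s assume "s \<in> {\<Sum>i\<in>F. p i | F. finite F \<and> F \<noteq> {}}"
    then obtain F where F: "finite F" "F \<noteq> {}" and s: "s = (\<Sum>i\<in>F. p i)" by auto
    have "s > 0" unfolding s using F p by (intro sum_pos) auto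
    moreover have "(f ^^ s) x \<in> V" using sums[OF F(1)] F W0 s by auto
    ultimately show "s \<in> return_times f x V" by (simp add: return_times_def)
  qed
  then show ?thesis unfolding contains_IP_set_def IP_set_def using p(1) by blast
qed

section \<open>Generic points of a weakly mixing set\<close>

lemma weakly_mixing_set_2:
  assumes "weakly_mixing_set 2 X f A"
    and "openin (top_of_set X) V1" "A \<inter> V1 \<noteq> {}" "openin (top_of_set X) U1" "A \<inter> U1 \<noteq> {}"
    and "openin (top_of_set X) V2" "A \<inter> V2 \<noteq> {}" "openin (top_of_set X) U2" "A \<inter> U2 \<noteq> {}"
  obtains k where "k > 0" "(f ^^ k) ` (V1 \<inter> A) \<inter> U1 \<noteq> {}" "(f ^^ k) ` (V2 \<inter> A) \<inter> U2 \<noteq> {}"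
proof -
  define V U where "V i = (if i = 1 then V1 else V2)" and "U i = (if i = 1 then U1 else U2)"
    for i :: nat
  have "\<forall>i\<in>{1..2}. openin (top_of_set X) (V i) \<and> openin (top_of_set X) (U i) \<and>
      A \<inter> U i \<noteq> {} \<and> A \<inter> V i \<noteq> {}"
    using assms(2-) by (simp add: V_def U_def)
  then obtain k where k: "k > 0" "\<forall>i\<in>{1..2}. (f ^^ k) ` (V i \<inter> A) \<inter> U i \<noteq> {}"
    using assms(1) unfolding weakly_mixing_set_def by blast
  show ?thesis
  proof (rule that[OF k(1)])
    show "(f ^^ k) ` (V1 \<inter> A) \<inter> U1 \<noteq> {}" "(f ^^ k) ` (V2 \<inter> A) \<inter> U2 \<noteq> {}"
      using bspec[OF k(2), of 1] bspec[OF k(2), of 2] by (simp_all add: V_def U_def)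
  qed
qed

text \<open>
  For fixed basic sets \<open>B\<close> and \<open>C\<close> meeting \<open>A\<close>, the set \<open>D B C\<close> of those \<open>x \<in> A\<close> that visit \<open>B\<close> at
  the same time as some point of \<open>C \<inter> A\<close> is open in \<open>A\<close>, and dense by weak mixing. A point in all
  these sets has dense sections.
\<close>

lemma generic_dense_sections:
  fixes X :: "'a::metric_space set"
  assumes f: "continuous_on X f" "f \<in> X \<rightarrow> X" and "compact A"
    and mix: "weakly_mixing_set 2 X f A"
    and \<B>: "countable \<B>" "\<And>B. B \<in> \<B> \<Longrightarrow> openin (top_of_set X) B \<and> A \<inter> B \<noteq> {}"
    and U: "openin (top_of_set X) U" "U \<inter> A \<noteq> {}"
  shows "\<exists>x\<in>U \<inter> A. \<forall>B\<in>\<B>. \<forall>C\<in>\<B>. \<exists>y\<in>C \<inter> A. \<exists>k>0. (f ^^ k) x \<in> B \<and> (f ^^ k) y \<in> B"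
proof -
  have "A \<subseteq> X"
    using mix closedin_imp_subset unfolding weakly_mixing_set_def by blast
  define D where "D B C = {x \<in> A. \<exists>y\<in>C \<inter> A. \<exists>k>0. (f ^^ k) x \<in> B \<and> (f ^^ k) y \<in> B}" for B C
  have openD: "openin (top_of_set A) (D B C)" if "B \<in> \<B>" for B C
  proof -
    have "D B C = {x \<in> A. \<exists>k\<in>{k. k > 0 \<and> (\<exists>y\<in>C \<inter> A. (f ^^ k) y \<in> B)}. (f ^^ k) x \<in> B}"
      unfolding D_def by auto
    then show ?thesis
      using openin_visits_within[OF f \<open>A \<subseteq> X\<close>] \<B>(2)[OF that] by presburger
  qed
  have denseD: "D B C \<inter> W \<noteq> {}"
    if "B \<in> \<B>" "C \<in> \<B>" and W: "openin (top_of_set A) W" "W \<noteq> {}" for B C W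
  proof -
    obtain T where T: "open T" "W = A \<inter> T" using W by (auto simp: openin_open)
    have "openin (top_of_set X) (X \<inter> T)" "A \<inter> (X \<inter> T) \<noteq> {}"
      using T W \<open>A \<subseteq> X\<close> by auto
    then obtain k where "k > 0" "(f ^^ k) ` (X \<inter> T \<inter> A) \<inter> B \<noteq> {}" "(f ^^ k) ` (C \<inter> A) \<inter> B \<noteq> {}"
      using weakly_mixing_set_2[OF mix, of "X \<inter> T" B C B] \<B>(2)[OF \<open>B \<in> \<B>\<close>] \<B>(2)[OF \<open>C \<in> \<B>\<close>]
      by blast
    then show ?thesis using T unfolding D_def by fast
  qed
  have "openin (top_of_set A) (U \<inter> A)"
    using openin_restrict[OF U(1) \<open>A \<subseteq> X\<close>] by (simp add: Int_commute)
  then have "\<exists>x\<in>U \<inter> A. \<forall>G\<in>(\<lambda>(B, C). D B C) ` (\<B> \<times> \<B>). x \<in> G"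
  proof (rule compact_Baire[OF \<open>compact A\<close> _ _ _ _ U(2), rotated -1])
    show "countable ((\<lambda>(B, C). D B C) ` (\<B> \<times> \<B>))"
      using \<B>(1) by simp
  next
    fix G assume "G \<in> (\<lambda>(B, C). D B C) ` (\<B> \<times> \<B>)"
    then obtain B C where G: "B \<in> \<B>" "C \<in> \<B>" "G = D B C" by blast
    then show "openin (top_of_set A) G" using openD by blast
    show "G \<inter> W \<noteq> {}" if "openin (top_of_set A) W" "W \<noteq> {}" for W
      using denseD that G by blast
  qed
  then obtain x where "x \<in> U \<inter> A" "\<And>B C. \<lbrakk>B \<in> \<B>; C \<in> \<B>\<rbrakk> \<Longrightarrow> x \<in> D B C"
    by blast
  then show ?thesis unfolding D_def by blast
qed

theorem theorem8:
  fixes X :: "'a::metric_space set" and f :: "'a \<Rightarrow> 'a" and A U :: "'a set"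
  assumes "top_dyn_sys X f"
    and "weakly_mixing_set 2 X f A"
    and "openin (top_of_set X) U"
    and "U \<inter> A \<noteq> {}"
  shows "(\<exists>x\<in>U \<inter> A. \<forall>V. openin (top_of_set X) V \<and> V \<inter> A \<noteq> {} \<longrightarrow>
              contains_IP_set (return_times f x V)) \<and>
         (\<forall>V. openin (top_of_set X) V \<and> V \<inter> A \<noteq> {} \<longrightarrow>
              contains_IP_set (hitting_times f (U \<inter> A) V))"
proof -
  have "compact X" and f: "continuous_on X f" "f \<in> X \<rightarrow> X"
    using assms(1) by (auto simp: top_dyn_sys_def)
  have A: "closedin (top_of_set X) A"
    using assms(2) by (simp add: weakly_mixing_set_def)
  then have "A \<subseteq> X" "compact A"
    using \<open>compact X\<close> closedin_imp_subset closedin_compact by blast+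
  obtain \<B>0 where \<B>0: "countable \<B>0" "\<And>B. B \<in> \<B>0 \<Longrightarrow> openin (top_of_set X) B"
    "\<And>W y. \<lbrakk>openin (top_of_set X) W; y \<in> W\<rbrakk> \<Longrightarrow> \<exists>B\<in>\<B>0. y \<in> B \<and> B \<subseteq> W"
    using compact_imp_second_countable[OF \<open>compact X\<close>] unfolding second_countable_def by metis
  define \<B> where "\<B> = {B \<in> \<B>0. A \<inter> B \<noteq> {}}"
  have \<B>: "countable \<B>" "\<And>B. B \<in> \<B> \<Longrightarrow> openin (top_of_set X) B \<and> A \<inter> B \<noteq> {}"
    using \<B>0(1,2) by (auto simp: \<B>_def)
  have base: "\<exists>B\<in>\<B>. y \<in> B \<and> B \<subseteq> W" if "openin (top_of_set X) W" "y \<in> W" "y \<in> A" for W y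
    using \<B>0(3)[OF that(1,2)] that(3) by (auto simp: \<B>_def)
  obtain x where x: "x \<in> U \<inter> A"
    and sections: "\<And>B C. \<lbrakk>B \<in> \<B>; C \<in> \<B>\<rbrakk> \<Longrightarrow> \<exists>y\<in>C \<inter> A. \<exists>k>0. (f ^^ k) x \<in> B \<and> (f ^^ k) y \<in> B"
    using generic_dense_sections[OF f \<open>compact A\<close> assms(2) \<B> assms(3,4)] by blast
  define E where "E B = {y \<in> A. \<exists>k>0. (f ^^ k) x \<in> B \<and> (f ^^ k) y \<in> B}" for B
  have openE: "openin (top_of_set A) (E B)" if "B \<in> \<B>" for B
  proof -
    have "E B = {y \<in> A. \<exists>k\<in>{k. k > 0 \<and> (f ^^ k) x \<in> B}. (f ^^ k) y \<in> B}"
      unfolding E_def by auto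
    then show ?thesis
      using openin_visits_within[OF f \<open>A \<subseteq> X\<close>] \<B>(2)[OF that] by presburger
  qed
  \<comment> \<open>Density of \<open>E B\<close> is the choice of \<open>x\<close>: every open set meeting \<open>A\<close> contains a basic \<open>C\<close>
    meeting \<open>A\<close>.\<close>
  have denseE: "E B \<inter> W \<noteq> {}" if "B \<in> \<B>" and W: "openin (top_of_set A) W" "W \<noteq> {}" for B W
  proof -
    obtain T where T: "open T" "W = A \<inter> T" using W by (auto simp: openin_open)
    then obtain y where y: "y \<in> A" "y \<in> T" using W by auto
    obtain C where "C \<in> \<B>" "C \<subseteq> X \<inter> T"
      using base[of "X \<inter> T" y] y T \<open>A \<subseteq> X\<close> by auto
    with sections[OF \<open>B \<in> \<B>\<close> \<open>C \<in> \<B>\<close>] T show ?thesis unfolding E_def by blast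
  qed
  have IP: "contains_IP_set (return_times f x V)"
    if V: "openin (top_of_set X) V" "V \<inter> A \<noteq> {}" for V
  proof -
    have "openin (top_of_set A) (A \<inter> V)" "A \<inter> V \<noteq> {}"
      using openin_restrict[OF V(1) \<open>A \<subseteq> X\<close>] V(2) by auto
    then have "\<exists>y\<in>A \<inter> V. \<forall>G\<in>E ` \<B>. y \<in> G"
    proof (rule compact_Baire[OF \<open>compact A\<close>, rotated -2])
      show "countable (E ` \<B>)" using \<B>(1) by simp
    qed (use openE denseE in blast)+
    then obtain y where y: "y \<in> A" "y \<in> V" "\<And>B. B \<in> \<B> \<Longrightarrow> y \<in> E B" by blast
    \<comment> \<open>The generic \<open>y\<close> lies in \<open>E B\<close> for every basic \<open>B\<close>, hence also for those around \<open>y\<close>.\<close>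
    have "\<exists>k>0. (f ^^ k) x \<in> W \<and> (f ^^ k) y \<in> W"
      if W: "openin (top_of_set X) W" "y \<in> W" for W
    proof -
      obtain B where "B \<in> \<B>" "B \<subseteq> W" using base[OF W y(1)] by blast
      with y(3)[of B] show ?thesis unfolding E_def by blast
    qed
    then show ?thesis by (rule return_times_contains_IP_set[OF f V(1) y(2)])
  qed
  have "return_times f x V \<subseteq> hitting_times f (U \<inter> A) V" for V
    using x by (auto simp: return_times_def hitting_times_def)
  with IP x show ?thesis unfolding contains_IP_set_def by (meson subset_trans)
qed

end
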